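(* Let $d \in \mathbb{N}$. For every finite, spherical set $A \subset \mathbb{R}^d$ and every real number $r$ with $0 < r < \mathrm{cr}(A)$, there is some $k = k(A,r) \in \mathbb{N}$ such that the following holds: for every $D \in \mathbb{N}$, there is a colouring of the points of $B_D(r)$ with $k$ colours such that no subset $A' \subset B_D(r)$ congruent to $A$ is monochromatic.
   Context: $\mathbb{N}$ denotes the positive integers and $\|\cdot\|$ the Euclidean norm. For $D \in \mathbb{N}$ and $r \ge 0$, $B_D(r) = \{x \in \mathbb{R}^D : \|x\| \le r\}$ is the closed $D$-dimensional ball of radius $r$ centred at the origin. A finite set $A \subset \mathbb{R}^d$ is called spherical if it lies on some sphere in $\mathbb{R}^d$, i.e. if there are $c \in \mathbb{R}^d$ and $\rho \ge 0$ with $\|x-c\| = \rho$ for all $x \in A$. The circumradius $\mathrm{cr}(A)$ of a spherical set $A \subset \mathbb{R}^d$ is the radius of the smallest sphere containing $A$, i.e. the smallest such $\rho$ (containing means that all points of $A$ lie on the sphere itself). Two sets, possibly in Euclidean spaces of different dimensions, are congruent if there is a distance-preserving bijection between them. A set is monochromatic if all of its points have the same colour. *)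

theory Defs
  imports "HOL-Analysis.Analysis"
begin

definition spherical :: "'a::metric_space set \<Rightarrow> bool" where
  "spherical A \<longleftrightarrow> (\<exists>c. \<exists>\<rho>\<ge>0. A \<subseteq> sphere c \<rho>)"

text \<open>
  For a spherical set in Euclidean space the least radius is attained, so the following
  is a genuine minimum; it carries no information for sets that are not spherical.
\<close>

definition circumradius :: "'a::metric_space set \<Rightarrow> real" where
  "circumradius A = (LEAST \<rho>. \<rho> \<ge> 0 \<and> (\<exists>c. A \<subseteq> sphere c \<rho>))"

text \<open>
  The ambient dimension \<open>D\<close> is bound inside a formula and so cannot be a type. The points of
  the \<open>D\<close>-dimensional space are therefore those of \<^const>\<open>Euclidean_space\<close>, i.e. functions
  \<open>nat \<Rightarrow> real\<close> vanishing from index \<open>D\<close> on. The type class distance on \<open>nat \<Rightarrow> real\<close>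
  metrizes the product topology and is not Euclidean, hence the explicit distance here.
\<close>

definition euclidean_norm :: "nat \<Rightarrow> (nat \<Rightarrow> real) \<Rightarrow> real" where
  "euclidean_norm D x = L2_set x {..<D}"

definition euclidean_dist :: "nat \<Rightarrow> (nat \<Rightarrow> real) \<Rightarrow> (nat \<Rightarrow> real) \<Rightarrow> real" where
  "euclidean_dist D x y = euclidean_norm D (\<lambda>i. x i - y i)"

definition euclidean_cball :: "nat \<Rightarrow> real \<Rightarrow> (nat \<Rightarrow> real) set" where
  "euclidean_cball D r = {x \<in> topspace (Euclidean_space D). euclidean_norm D x \<le> r}"

definition congruent_sets ::
    "('a \<Rightarrow> 'a \<Rightarrow> real) \<Rightarrow> 'a set \<Rightarrow> ('b \<Rightarrow> 'b \<Rightarrow> real) \<Rightarrow> 'b set \<Rightarrow> bool" where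
  "congruent_sets dA A dB B \<longleftrightarrow>
     (\<exists>f. bij_betw f A B \<and> (\<forall>x\<in>A. \<forall>y\<in>A. dB (f x) (f y) = dA x y))"

definition monochromatic :: "('a \<Rightarrow> 'c) \<Rightarrow> 'a set \<Rightarrow> bool" where
  "monochromatic col S \<longleftrightarrow> (\<forall>x\<in>S. \<forall>y\<in>S. col x = col y)"

end

theory Submission
  imports Defs
begin

text \<open>
  If \<open>c = (\<Sum>i. u i *\<^sub>R x i)\<close> is the circumcentre of \<open>A\<close>, with \<open>(\<Sum>i. u i) = 1\<close>, then every congruent
  copy \<open>y\<close> of \<open>A\<close> satisfies \<open>(\<Sum>i. u i * \<bar>y i\<bar>\<^sup>2) = cr(A)\<^sup>2 + \<bar>\<Sum>i. u i *\<^sub>R y i\<bar>\<^sup>2 \<ge> cr(A)\<^sup>2\<close>, since the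
  difference of the squares depends only on the pairwise distances. If all \<open>\<bar>y i\<bar>\<^sup>2\<close> lie in a common
  short subinterval of \<open>[0, r\<^sup>2]\<close>, the left-hand side is close to a number that is at most
  \<open>r\<^sup>2 < cr(A)\<^sup>2\<close>. Hence it suffices to colour \<open>x\<close> by the subinterval containing \<open>\<bar>x\<bar>\<^sup>2\<close>.
\<close>

text \<open>Expand each squared distance into two squared norms minus twice an inner product.
  Because the weights sum to 1, each of the two kinds of square contributes the left-hand side once,
  and the inner products assemble to the norm of the combination. The weights may be
  negative.\<close>

lemma affine_combination_norm_sq:
  fixes f :: "'i \<Rightarrow> 'a::real_inner"
  assumes "sum u S = 1"
  shows "(\<Sum>i\<in>S. u i * (norm (f i))\<^sup>2) =
    (norm (\<Sum>i\<in>S. u i *\<^sub>R f i))\<^sup>2 + (\<Sum>i\<in>S. \<Sum>j\<in>S. u i * u j * (dist (f i) (f j))\<^sup>2) / 2"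
proof -
  let ?N = "\<Sum>i\<in>S. u i * (norm (f i))\<^sup>2"
  have sq: "(norm (\<Sum>i\<in>S. u i *\<^sub>R f i))\<^sup>2 = (\<Sum>i\<in>S. \<Sum>j\<in>S. u i * u j * (f i \<bullet> f j))"
    unfolding power2_norm_eq_inner inner_sum_left inner_sum_right
    by (intro sum.cong) (auto simp: mult_ac inner_commute)
  have "(\<Sum>i\<in>S. \<Sum>j\<in>S. u i * u j * (dist (f i) (f j))\<^sup>2) =
      (\<Sum>i\<in>S. \<Sum>j\<in>S. u j * (u i * (norm (f i))\<^sup>2)) + (\<Sum>i\<in>S. \<Sum>j\<in>S. u i * (u j * (norm (f j))\<^sup>2))
      - 2 * (\<Sum>i\<in>S. \<Sum>j\<in>S. u i * u j * (f i \<bullet> f j))"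
    unfolding sum_distrib_left sum.distrib[symmetric] sum_subtractf[symmetric]
    by (intro sum.cong)
      (auto simp: dist_norm power2_norm_eq_inner inner_diff inner_commute algebra_simps)
  also have "(\<Sum>i\<in>S. \<Sum>j\<in>S. u j * (u i * (norm (f i))\<^sup>2)) = ?N"
    by (simp add: sum_distrib_right[symmetric] assms)
  also have "(\<Sum>i\<in>S. \<Sum>j\<in>S. u i * (u j * (norm (f j))\<^sup>2)) = ?N"
    by (simp add: sum_distrib_left[symmetric] sum_distrib_right[symmetric] assms)
  finally show ?thesis
    using sq by linarith
qed

text \<open>The identity above is applied in each coordinate, viewed as a family of reals, and the
  nonnegative square of the combination is dropped. Working by coordinates connects it with
  \<open>euclidean_dist\<close>, which is not a type class distance.\<close>

lemma affine_combination_euclidean_norm_sq_ge: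
  assumes "sum u S = 1"
  shows "(\<Sum>i\<in>S. \<Sum>j\<in>S. u i * u j * (euclidean_dist D (f i) (f j))\<^sup>2) / 2
    \<le> (\<Sum>i\<in>S. u i * (euclidean_norm D (f i))\<^sup>2)"
proof -
  have "(\<Sum>i\<in>S. \<Sum>j\<in>S. u i * u j * (euclidean_dist D (f i) (f j))\<^sup>2) / 2
      = (\<Sum>l<D. (\<Sum>i\<in>S. \<Sum>j\<in>S. u i * u j * (f i l - f j l)\<^sup>2) / 2)"
    unfolding sum_divide_distrib[symmetric]
    by (simp add: euclidean_dist_def euclidean_norm_def L2_set_def sum_nonneg sum_distrib_left
        sum.swap[of _ "{..<D}"])
  also have "\<dots> \<le> (\<Sum>l<D. \<Sum>i\<in>S. u i * (f i l)\<^sup>2)"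
  proof (rule sum_mono)
    fix l
    show "(\<Sum>i\<in>S. \<Sum>j\<in>S. u i * u j * (f i l - f j l)\<^sup>2) / 2 \<le> (\<Sum>i\<in>S. u i * (f i l)\<^sup>2)"
      using affine_combination_norm_sq[OF assms, of "\<lambda>i. f i l"] by (simp add: dist_real_def)
  qed
  also have "\<dots> = (\<Sum>i\<in>S. u i * (euclidean_norm D (f i))\<^sup>2)"
    by (simp add: euclidean_norm_def L2_set_def sum_nonneg sum_distrib_left
        sum.swap[of _ "{..<D}"])
  finally show ?thesis .
qed

text \<open>An affine set also contains the reflection of \<open>x\<close> in the closest point. The
  obtuse-angle inequality for \<open>x\<close> and for its reflection bounds the same inner product
  from both sides.\<close>

lemma closest_point_affine_orthogonal:
  fixes S :: "'a::euclidean_space set"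
  assumes "affine S" "x \<in> S"
  shows "orthogonal (x - closest_point S a) (a - closest_point S a)"
proof -
  let ?p = "closest_point S a"
  have S: "convex S" "closed S"
    using assms(1) by (auto intro: affine_imp_convex affine_closed)
  then have "?p \<in> S"
    using assms(2) by (intro closest_point_in_set) auto
  then have "2 *\<^sub>R ?p + (-1) *\<^sub>R x \<in> S"
    using assms by (intro mem_affine) auto
  then have "(a - ?p) \<bullet> (2 *\<^sub>R ?p + (-1) *\<^sub>R x - ?p) \<le> 0"
    by (rule closest_point_dot[OF S])
  moreover have "2 *\<^sub>R ?p + (-1) *\<^sub>R x - ?p = - (x - ?p)"
    by (simp add: scaleR_2)
  ultimately have "(a - ?p) \<bullet> (x - ?p) \<ge> 0"
    by (simp only: inner_minus_right)
  moreover have "(a - ?p) \<bullet> (x - ?p) \<le> 0"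
    by (rule closest_point_dot[OF S assms(2)])
  ultimately show ?thesis
    by (simp add: orthogonal_def inner_commute)
qed

text \<open>Project the centre of any sphere through \<open>A\<close> onto the affine hull. By
  Pythagoras the projection is still equidistant from all points of \<open>A\<close>.\<close>

lemma spherical_centre_in_affine_hull:
  fixes A :: "'a::euclidean_space set"
  assumes "spherical A" "A \<noteq> {}"
  obtains c \<rho> where "c \<in> affine hull A" "\<rho> \<ge> 0" "A \<subseteq> sphere c \<rho>"
proof -
  obtain a \<sigma> where a: "A \<subseteq> sphere a \<sigma>"
    using assms by (auto simp: spherical_def)
  define c where "c = closest_point (affine hull A) a"
  have c: "c \<in> affine hull A"
    unfolding c_def using assms by (intro closest_point_in_set) auto
  have "(dist c x)\<^sup>2 = \<sigma>\<^sup>2 - (dist a c)\<^sup>2" if "x \<in> A" for x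
  proof -
    have "orthogonal (x - c) (a - c)"
      unfolding c_def using that by (intro closest_point_affine_orthogonal) (auto intro: hull_inc)
    then have "(norm (x - c))\<^sup>2 + (norm (a - c))\<^sup>2 = (norm (a - x))\<^sup>2"
      by (simp add: orthogonal_def power2_norm_eq_inner inner_diff inner_commute algebra_simps)
    moreover have "dist a x = \<sigma>"
      using a that by auto
    ultimately show ?thesis
      by (simp add: dist_norm norm_minus_commute algebra_simps)
  qed
  then have "dist c x = sqrt (\<sigma>\<^sup>2 - (dist a c)\<^sup>2)" if "x \<in> A" for x
    using that by (metis real_sqrt_unique zero_le_dist)
  then have sphere: "A \<subseteq> sphere c (sqrt (\<sigma>\<^sup>2 - (dist a c)\<^sup>2))"
    by auto
  \<comment> \<open>\<open>sqrt\<close> is negative at negative arguments, so the sign comes from a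
    point of \<open>A\<close>, whose distance from \<open>c\<close> is this number.\<close>
  moreover have "0 \<le> sqrt (\<sigma>\<^sup>2 - (dist a c)\<^sup>2)"
    using assms(2) sphere by (metis ex_in_conv mem_sphere subsetD zero_le_dist)
  ultimately show ?thesis
    using c that by blast
qed

text \<open>The weights are affine coordinates of the circumcentre. The formula involves only
  pairwise distances, so it transfers to every congruent copy.\<close>

lemma circumradius_affine_combination:
  fixes A :: "'a::euclidean_space set"
  assumes "finite A" "spherical A" "A \<noteq> {}"
  obtains u where "sum u A = 1"
    "(circumradius A)\<^sup>2 = (\<Sum>x\<in>A. \<Sum>y\<in>A. u x * u y * (dist x y)\<^sup>2) / 2"
proof -
  obtain c \<rho> where c: "c \<in> affine hull A" and \<rho>: "\<rho> \<ge> 0" "A \<subseteq> sphere c \<rho>"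
    using spherical_centre_in_affine_hull assms by blast
  obtain u where u: "sum u A = 1" "(\<Sum>x\<in>A. u x *\<^sub>R x) = c"
    using c by (auto simp: affine_hull_finite assms)
  define V where "V = (\<Sum>x\<in>A. \<Sum>y\<in>A. u x * u y * (dist x y)\<^sup>2) / 2"
  \<comment> \<open>The identity for the translated points \<open>x - b\<close> splits the squared
    radius of any sphere through \<open>A\<close> into the squared distance of its centre from
    \<open>c\<close> and a constant, so the sphere around \<open>c\<close> is the smallest.\<close>
  have radius: "\<sigma>\<^sup>2 = (norm (c - b))\<^sup>2 + V" if "A \<subseteq> sphere b \<sigma>" for b \<sigma>
  proof -
    have "(\<Sum>x\<in>A. u x * (norm (x - b))\<^sup>2) = (\<Sum>x\<in>A. u x * \<sigma>\<^sup>2)"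
      using that by (intro sum.cong) (auto simp: dist_norm norm_minus_commute)
    moreover have "(\<Sum>x\<in>A. u x *\<^sub>R (x - b)) = c - b"
      using u by (simp add: scaleR_diff_right sum_subtractf scaleR_left.sum[symmetric])
    ultimately show ?thesis
      using affine_combination_norm_sq[OF u(1), of "\<lambda>x. x - b"]
      by (simp add: V_def u(1) sum_distrib_right[symmetric] dist_norm)
  qed
  have V: "\<rho>\<^sup>2 = V"
    using radius[OF \<rho>(2)] by simp
  have "circumradius A = \<rho>"
    unfolding circumradius_def
  proof (rule Least_equality)
    show "\<rho> \<ge> 0 \<and> (\<exists>c. A \<subseteq> sphere c \<rho>)"
      using \<rho> by blast
  next
    fix \<sigma> assume \<sigma>: "\<sigma> \<ge> 0 \<and> (\<exists>b. A \<subseteq> sphere b \<sigma>)"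
    then obtain b where "A \<subseteq> sphere b \<sigma>"
      by blast
    from radius[OF this] have "\<rho>\<^sup>2 \<le> \<sigma>\<^sup>2"
      using V by simp
    then show "\<rho> \<le> \<sigma>"
      using \<sigma> by (auto intro: power2_le_imp_le)
  qed
  then show ?thesis
    using u(1) V by (intro that[of u]) (simp_all add: V_def)
qed

lemma floor_eq_imp_dist_less:
  fixes x y \<epsilon> :: real
  assumes "\<epsilon> > 0" "\<lfloor>x / \<epsilon>\<rfloor> = \<lfloor>y / \<epsilon>\<rfloor>"
  shows "\<bar>x - y\<bar> < \<epsilon>"
proof -
  have "\<bar>x / \<epsilon> - y / \<epsilon>\<bar> < 1"
    using assms(2) by linarith
  then show ?thesis
    using assms(1) by (simp add: diff_divide_distrib[symmetric])
qed

theorem theorem1p5: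
  fixes A :: "(real ^ 'd) set" and r :: real
  assumes "finite A" and "spherical A"
    and "0 < r" and "r < circumradius A"
  shows "\<exists>k::nat. k \<ge> 1 \<and>
           (\<forall>D::nat. D \<ge> 1 \<longrightarrow>
             (\<exists>col :: (nat \<Rightarrow> real) \<Rightarrow> nat.
                col \<in> euclidean_cball D r \<rightarrow> {..<k} \<and>
                \<not> (\<exists>A'. A' \<subseteq> euclidean_cball D r \<and>
                        congruent_sets dist A (euclidean_dist D) A' \<and>
                        monochromatic col A')))"
proof -
  have "circumradius ({} :: (real ^ 'd) set) = 0"
    unfolding circumradius_def by (rule Least_equality) auto
  then have "A \<noteq> {}"
    using assms(3,4) by auto
  then obtain u where u: "sum u A = 1"
    and cr: "(circumradius A)\<^sup>2 = (\<Sum>x\<in>A. \<Sum>y\<in>A. u x * u y * (dist x y)\<^sup>2) / 2"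
    using circumradius_affine_combination[OF assms(1,2)] by blast
  define U where "U = (\<Sum>x\<in>A. \<bar>u x\<bar>)"
  have "U > 0"
    using sum_abs[of u A] u by (simp add: U_def)
  \<comment> \<open>Changing each squared norm by at most \<epsilon> moves the weighted sum by at
    most \<open>\<epsilon> * U\<close>, which is half the gap between the squared radii.\<close>
  define \<epsilon> where "\<epsilon> = ((circumradius A)\<^sup>2 - r\<^sup>2) / (2 * U)"
  have gap: "r\<^sup>2 < (circumradius A)\<^sup>2"
    using assms(3,4) by (simp add: power_strict_mono)
  have "\<epsilon> > 0"
    using gap \<open>U > 0\<close> by (simp add: \<epsilon>_def)
  have \<epsilon>U: "\<epsilon> * U < (circumradius A)\<^sup>2 - r\<^sup>2"
    using gap \<open>U > 0\<close> by (simp add: \<epsilon>_def)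
  \<comment> \<open>The floors occurring on the ball run from 0 to that of
    \<open>r\<^sup>2 / \<epsilon>\<close>, both included, hence the successor. Nothing here depends
    on the dimension.\<close>
  define k where "k = Suc (nat \<lfloor>r\<^sup>2 / \<epsilon>\<rfloor>)"
  have "\<exists>col :: (nat \<Rightarrow> real) \<Rightarrow> nat.
                col \<in> euclidean_cball D r \<rightarrow> {..<k} \<and>
                \<not> (\<exists>A'. A' \<subseteq> euclidean_cball D r \<and>
                        congruent_sets dist A (euclidean_dist D) A' \<and>
                        monochromatic col A')" for D
  proof -
    define col where "col x = nat \<lfloor>(euclidean_norm D x)\<^sup>2 / \<epsilon>\<rfloor>" for x
    have ball: "(euclidean_norm D x)\<^sup>2 \<le> r\<^sup>2" if "x \<in> euclidean_cball D r" for x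
      using that by (auto simp: euclidean_cball_def euclidean_norm_def intro!: power_mono)
    have "col x < k" if "x \<in> euclidean_cball D r" for x
      using ball[OF that] \<open>\<epsilon> > 0\<close>
      by (auto simp: col_def k_def less_Suc_eq_le intro!: nat_mono floor_mono divide_right_mono)
    moreover have False
      if A': "A' \<subseteq> euclidean_cball D r" "congruent_sets dist A (euclidean_dist D) A'"
        "monochromatic col A'" for A'
    proof -
      obtain f where f: "bij_betw f A A'"
        and iso: "\<And>x y. x \<in> A \<Longrightarrow> y \<in> A \<Longrightarrow> euclidean_dist D (f x) (f y) = dist x y"
        using A'(2) unfolding congruent_sets_def by blast
      have fA: "f x \<in> A'" if "x \<in> A" for x
        using f that by (auto simp: bij_betw_def)
      obtain a where a: "a \<in> A"
        using \<open>A \<noteq> {}\<close> by blast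
      define N where "N x = (euclidean_norm D (f x))\<^sup>2" for x
      have close: "\<bar>N x - N a\<bar> \<le> \<epsilon>" if "x \<in> A" for x
      proof -
        have "col (f x) = col (f a)"
          using A'(3) fA that a by (auto simp: monochromatic_def)
        then have "\<lfloor>N x / \<epsilon>\<rfloor> = \<lfloor>N a / \<epsilon>\<rfloor>"
          using \<open>\<epsilon> > 0\<close> by (simp add: col_def N_def eq_nat_nat_iff)
        then show ?thesis
          using floor_eq_imp_dist_less[OF \<open>\<epsilon> > 0\<close>] less_imp_le by blast
      qed
      have "(circumradius A)\<^sup>2 \<le> (\<Sum>x\<in>A. u x * N x)"
        using affine_combination_euclidean_norm_sq_ge[OF u, of D f]
        by (simp add: cr N_def iso)
      \<comment> \<open>Since the weights sum to 1, a reference value can be split off: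
        \<open>N a\<close> is at most \<open>r\<^sup>2\<close>, and only differences within one
        colour class remain.\<close>
      also have "\<dots> = N a + (\<Sum>x\<in>A. u x * (N x - N a))"
        by (simp add: right_diff_distrib sum_subtractf sum_distrib_right[symmetric] u)
      also have "(\<Sum>x\<in>A. u x * (N x - N a)) \<le> (\<Sum>x\<in>A. \<bar>u x\<bar> * \<epsilon>)"
      proof (rule sum_mono)
        fix x assume "x \<in> A"
        have "u x * (N x - N a) \<le> \<bar>u x\<bar> * \<bar>N x - N a\<bar>"
          by (metis abs_ge_self abs_mult)
        also have "\<dots> \<le> \<bar>u x\<bar> * \<epsilon>"
          using close[OF \<open>x \<in> A\<close>] by (intro mult_left_mono) auto
        finally show "u x * (N x - N a) \<le> \<bar>u x\<bar> * \<epsilon>" .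
      qed
      also have "N a + (\<Sum>x\<in>A. \<bar>u x\<bar> * \<epsilon>) \<le> r\<^sup>2 + \<epsilon> * U"
        using ball fA[OF a] A'(1) by (auto simp: N_def U_def sum_distrib_left mult.commute)
      finally show False
        using \<epsilon>U by simp
    qed
    ultimately show ?thesis
      by (intro exI[of _ col]) auto
  qed
  then show ?thesis
    by (intro exI[of _ k]) (auto simp: k_def)
qed

end
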